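(* Let $q$ be a prime power, let $M \ge 1$ and $1 \le k < n$ be integers, and let $P \in \mathbb{F}_{q^M}^{k\times(n-k)}$. Let $\mathcal{C} = \{uG : u \in \mathbb{F}_{q^M}^k\} \subseteq \mathbb{F}_{q^M}^n$ be the $\mathbb{F}_{q^M}$-linear block code with systematic encoder $G = [I_k,\ P] \in \mathbb{F}_{q^M}^{k\times n}$. Then the following statements are equivalent. 1. $\mathcal{C}$ is MRD. 2. The matrix $BP\widetilde{A} + C \in \mathbb{F}_{q^M}^{k\times(n-k)}$ is full superregular for all matrices $C \in \mathbb{F}_q^{k\times(n-k)}$ and all nonsingular upper triangular matrices $B \in \mathbb{F}_q^{k\times k}$ and $\widetilde{A} \in \mathbb{F}_q^{(n-k)\times(n-k)}$.
   Context: Fix a basis of $\mathbb{F}_{q^M}$ over $\mathbb{F}_q$ and let $M_n : \mathbb{F}_{q^M}^n \to \mathbb{F}_q^{M\times n}$ be the $\mathbb{F}_q$-linear isomorphism expanding each coordinate as a column vector in $\mathbb{F}_q^M$ with respect to this basis. For $v \in \mathbb{F}_{q^M}^n$ put $\mathrm{rank}(v) = \mathrm{rank}_{\mathbb{F}_q}(M_n(v))$ (equivalently, the $\mathbb{F}_q$-dimension of the $\mathbb{F}_q$-span of the coordinates of $v$). The minimum rank distance of an $\mathbb{F}_{q^M}$-linear code $\mathcal{C} \subseteq \mathbb{F}_{q^M}^n$ is $d_R(\mathcal{C}) = \min\{\mathrm{rank}(v) : v \in \mathcal{C},\ v \ne 0\}$. A $k$-dimensional $\mathbb{F}_{q^M}$-linear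 code $\mathcal{C}\subseteq \mathbb{F}_{q^M}^n$ always satisfies $d_R(\mathcal{C}) \le n-k+1$, and it is called MRD (maximum rank distance) if $d_R(\mathcal{C}) = n-k+1$. A matrix over $\mathbb{F}_{q^M}$ is called full superregular if all its minors, of every size, are nonzero (in particular all its entries are nonzero). *)

theory Defs
  imports
    "HOL-Library.Cardinality"
    "HOL-Number_Theory.Prime_Powers"
    "Jordan_Normal_Form.DL_Rank"
    "Jordan_Normal_Form.DL_Submatrix"
begin

text \<open>
  The extension \<open>F_{q^M} / F_q\<close> is modelled by two finite field types \<open>'k\<close> and \<open>'a\<close>
  together with a field homomorphism (hence embedding) \<open>\<iota> :: 'k \<Rightarrow> 'a\<close>, which turns \<open>'a\<close> into
  a vector space over \<open>'k\<close>. Matrices over \<open>F_q\<close> are moved to \<open>F_{q^M}\<close> by \<open>map_mat \<iota>\<close>.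
\<close>

definition ext_scale :: "('k::field \<Rightarrow> 'a::field) \<Rightarrow> 'k \<Rightarrow> 'a \<Rightarrow> 'a" where
  "ext_scale \<iota> c x = \<iota> c * x"

lemma vector_space_ext_scale: "field_hom \<iota> \<Longrightarrow> vector_space (ext_scale \<iota>)"
proof -
  assume "field_hom \<iota>"
  then interpret field_hom \<iota> .
  show ?thesis
    by unfold_locales (simp_all add: ext_scale_def algebra_simps hom_add hom_mult)
qed

definition ordered_basis :: "('k::field \<Rightarrow> 'a::field) \<Rightarrow> 'a list \<Rightarrow> bool" where
  "ordered_basis \<iota> bs \<longleftrightarrow>
     distinct bs \<and>
     \<not> Modules.module.dependent (ext_scale \<iota>) (set bs) \<and>
     Modules.module.span (ext_scale \<iota>) (set bs) = UNIV"

text \<open>Column \<open>j\<close> of the expansion of \<open>v\<close> holds the coordinates of \<open>v $ j\<close> with respect to \<open>bs\<close>.\<close>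

definition expansion_mat :: "('k::field \<Rightarrow> 'a::field) \<Rightarrow> 'a list \<Rightarrow> 'a vec \<Rightarrow> 'k mat" where
  "expansion_mat \<iota> bs v =
     mat (length bs) (dim_vec v)
       (\<lambda>(i, j). Modules.module.representation (ext_scale \<iota>) (set bs) (v $ j) (bs ! i))"

definition rank_weight :: "('k::field \<Rightarrow> 'a::field) \<Rightarrow> 'a list \<Rightarrow> 'a vec \<Rightarrow> nat" where
  "rank_weight \<iota> bs v = vec_space.rank (length bs) (expansion_mat \<iota> bs v)"

text \<open>
  For a finite field \<open>'a\<close> the minimum is over a finite set, which is nonempty as soon as the
  code is nonzero.
\<close>

definition min_rank_distance ::
    "('k::field \<Rightarrow> 'a::field) \<Rightarrow> 'a list \<Rightarrow> nat \<Rightarrow> 'a vec set \<Rightarrow> nat" where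
  "min_rank_distance \<iota> bs n C = Min (rank_weight \<iota> bs ` {v \<in> C. v \<noteq> 0\<^sub>v n})"

definition linear_code :: "nat \<Rightarrow> 'a::field vec set \<Rightarrow> bool" where
  "linear_code n C \<longleftrightarrow> VectorSpace.subspace class_ring C (module_vec TYPE('a) n)"

definition code_dim :: "nat \<Rightarrow> 'a::field vec set \<Rightarrow> nat" where
  "code_dim n C = vectorspace.dim class_ring ((module_vec TYPE('a) n)\<lparr>carrier := C\<rparr>)"

definition is_MRD :: "('k::field \<Rightarrow> 'a::field) \<Rightarrow> 'a list \<Rightarrow> nat \<Rightarrow> 'a vec set \<Rightarrow> bool" where
  "is_MRD \<iota> bs n C \<longleftrightarrow>
     linear_code n C \<and> min_rank_distance \<iota> bs n C = n - code_dim n C + 1"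

text \<open>The block matrix \<open>[I_k, P]\<close>; the two lower blocks have no rows.\<close>

definition systematic_encoder :: "nat \<Rightarrow> 'a::{zero,one} mat \<Rightarrow> 'a mat" where
  "systematic_encoder k P =
     four_block_mat (1\<^sub>m k) P (0\<^sub>m 0 k) (0\<^sub>m 0 (dim_col P))"

text \<open>Vectors are columns in the library, so \<open>u G\<close> is written as \<open>G\<^sup>T u\<close>.\<close>

definition code_of :: "'a::comm_semiring_0 mat \<Rightarrow> 'a vec set" where
  "code_of G = {transpose_mat G *\<^sub>v u | u. u \<in> carrier_vec (dim_row G)}"

definition full_superregular :: "'a::comm_ring_1 mat \<Rightarrow> bool" where
  "full_superregular A \<longleftrightarrow>
     (\<forall>I J. I \<subseteq> {..<dim_row A} \<and> J \<subseteq> {..<dim_col A} \<and> I \<noteq> {} \<and> card I = card J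
        \<longrightarrow> det (submatrix A I J) \<noteq> 0)"

end

theory Submission
  imports Defs
begin

text \<open>
  Two dictionaries reduce the theorem to linear algebra over \<open>F_q\<close>. A square submatrix of \<open>Q\<close> is singular
  iff some combination of its rows vanishes; hence \<open>Q\<close> is full superregular iff every nonzero codeword
  \<open>(x, x Q)\<close> has fewer than \<open>k\<close> zero coordinates, so no signs of determinants have to be tracked.
  The rank weight is the dimension of the \<open>F_q\<close>-span of the coordinates; hence the code is MRD iff the
  coordinates of every nonzero \<open>(u, u P)\<close> span more than \<open>n - k\<close> dimensions. With
  \<open>Q = B P A + C\<close> and \<open>u = x B\<close>, the coordinates of \<open>(x, x Q)\<close> span those of \<open>(u, u P)\<close>, so many zeros force
  small rank. Conversely, if \<open>(u, u P)\<close> has small rank, then at least \<open>k\<close> coordinates are combinations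
  of earlier ones and can be cleared by an upper triangular column operation.
\<close>


section \<open>Full superregularity and zeros of codewords\<close>

lemma bij_betw_pick:
  assumes "finite I"
  shows "bij_betw (pick I) {..<card I} I"
proof (rule bij_betw_byWitness[where f' = "\<lambda>i. card {a \<in> I. a < i}"])
  show "\<forall>i\<in>{..<card I}. card {a \<in> I. a < pick I i} = i"
    by (simp add: card_pick)
  show "\<forall>i\<in>I. pick I (card {a \<in> I. a < i}) = i"
    by (simp add: pick_card_in_set)
  show "pick I ` {..<card I} \<subseteq> I"
    by (auto simp: pick_in_set)
  show "(\<lambda>i. card {a \<in> I. a < i}) ` I \<subseteq> {..<card I}"
    using assms by (auto intro!: psubset_card_mono)
qed

lemma transpose_mult_vec_index:
  assumes "Q \<in> carrier_mat k m" "x \<in> carrier_vec k" "j < m"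
  shows "(Q\<^sup>T *\<^sub>v x) $ j = (\<Sum>i<k. Q $$ (i, j) * x $ i)"
  using assms by (auto simp: scalar_prod_def lessThan_atLeast0 intro!: sum.cong)

lemma vec_set_carrier: "v \<in> carrier_vec n \<Longrightarrow> vec_set v = ($) v ` {..<n}"
  by (simp add: vec_set_def)

lemma vec_set_append_vec: "vec_set (u @\<^sub>v w) = vec_set u \<union> vec_set w"
  by (simp flip: set_list_of_vec add: list_of_vec_append)

lemma nonzero_vecE:
  assumes "x \<in> carrier_vec k" "x \<noteq> 0\<^sub>v k"
  obtains i where "i < k" "x $ i \<noteq> 0"
  using assms by (metis carrier_vecD eq_vecI index_zero_vec)

lemma submatrix_carrier:
  assumes "Q \<in> carrier_mat k m" "I \<subseteq> {..<k}" "J \<subseteq> {..<m}"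
  shows "submatrix Q I J \<in> carrier_mat (card I) (card J)"
proof -
  have "{i. i < dim_row Q \<and> i \<in> I} = I" "{j. j < dim_col Q \<and> j \<in> J} = J"
    using assms by auto
  then show ?thesis
    using dim_submatrix[of Q I J] by (metis carrier_matI)
qed

lemma transpose_mult_vec_carrier: "Q \<in> carrier_mat k m \<Longrightarrow> Q\<^sup>T *\<^sub>v x \<in> carrier_vec m"
  by (auto intro!: carrier_vecI)

lemma submatrix_transpose_mult_vec_index:
  assumes "Q \<in> carrier_mat k m" "I \<subseteq> {..<k}" "J \<subseteq> {..<m}"
    and "x \<in> carrier_vec k" "\<And>i. i < k \<Longrightarrow> i \<notin> I \<Longrightarrow> x $ i = 0"
    and "j < card J"
  shows "((submatrix Q I J)\<^sup>T *\<^sub>v vec (card I) (\<lambda>i. x $ pick I i)) $ j = (Q\<^sup>T *\<^sub>v x) $ pick J j"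
proof -
  have I: "{i. i < dim_row Q \<and> i \<in> I} = I" and J: "{j. j < dim_col Q \<and> j \<in> J} = J"
    using assms(1-3) by auto
  have sub: "submatrix Q I J \<in> carrier_mat (card I) (card J)"
    by (rule submatrix_carrier[OF assms(1-3)])
  have pj: "pick J j < m"
    using assms(3) pick_in_set[of j J] assms(6) by auto
  have "((submatrix Q I J)\<^sup>T *\<^sub>v vec (card I) (\<lambda>i. x $ pick I i)) $ j =
      (\<Sum>i<card I. Q $$ (pick I i, pick J j) * x $ pick I i)"
    using assms(6)
    by (simp add: transpose_mult_vec_index[OF sub] submatrix_index[of _ Q I _ J, unfolded I J]
      del: index_mult_mat_vec)
  also have "\<dots> = (\<Sum>i\<in>I. Q $$ (i, pick J j) * x $ i)"
    using assms(2) finite_subset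
    by (intro sum.reindex_bij_betw[where g = "\<lambda>i. Q $$ (i, pick J j) * x $ i"] bij_betw_pick) auto
  also have "\<dots> = (\<Sum>i<k. Q $$ (i, pick J j) * x $ i)"
    using assms(2,5) by (intro sum.mono_neutral_left) auto
  also have "\<dots> = (Q\<^sup>T *\<^sub>v x) $ pick J j"
    by (rule transpose_mult_vec_index[OF assms(1,4) pj, symmetric])
  finally show ?thesis .
qed

text \<open>If \<open>x\<close> has support \<open>I\<close> and \<open>x Q\<close> has at least
  \<open>card I\<close> zeros, then the entries of \<open>x\<close> on \<open>I\<close> form a
  kernel vector of the transpose of a square submatrix. Conversely, a kernel vector of such a
  transpose, extended by zero, has at least \<open>k - card I\<close> zeros, and its image has at
  least \<open>card J = card I\<close> more, which makes \<open>k\<close> in all.\<close>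

lemma full_superregular_iff_few_zeros:
  fixes Q :: "'a::field mat"
  assumes Q: "Q \<in> carrier_mat k m"
  shows "full_superregular Q \<longleftrightarrow>
    (\<forall>x \<in> carrier_vec k. x \<noteq> 0\<^sub>v k \<longrightarrow>
      card {i. i < k \<and> x $ i = 0} + card {j. j < m \<and> (Q\<^sup>T *\<^sub>v x) $ j = 0} < k)"
proof (intro iffI ballI impI)
  fix x :: "'a vec"
  assume reg: "full_superregular Q" and x: "x \<in> carrier_vec k" "x \<noteq> 0\<^sub>v k"
  define I where "I = {i. i < k \<and> x $ i \<noteq> 0}"
  define Z where "Z = {j. j < m \<and> (Q\<^sup>T *\<^sub>v x) $ j = 0}"
  have "card I + card {i. i < k \<and> x $ i = 0} = card (I \<union> {i. i < k \<and> x $ i = 0})"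
    by (intro card_Un_disjoint[symmetric]) (auto simp: I_def)
  also have "I \<union> {i. i < k \<and> x $ i = 0} = {..<k}" by (auto simp: I_def)
  finally have cI: "card I + card {i. i < k \<and> x $ i = 0} = k" by simp
  have "\<not> card I \<le> card Z"
  proof
    assume "card I \<le> card Z"
    \<comment> \<open>Cutting the zero set of \<open>x Q\<close> down to exactly
      \<open>card I\<close> columns makes the submatrix square.\<close>
    then obtain J where J: "J \<subseteq> Z" "card J = card I"
      using obtain_subset_with_card_n by metis
    have IJ: "I \<subseteq> {..<k}" "J \<subseteq> {..<m}" using J(1) by (auto simp: I_def Z_def)
    then have sub: "submatrix Q I J \<in> carrier_mat (card I) (card I)"
      using submatrix_carrier[OF Q IJ] J(2) by simp
    obtain i where i: "i \<in> I"
      using nonzero_vecE[OF x] by (auto simp: I_def)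
    let ?y = "vec (card I) (\<lambda>i. x $ pick I i)"
    have "(submatrix Q I J)\<^sup>T *\<^sub>v ?y = 0\<^sub>v (card I)"
    proof (rule eq_vecI)
      fix j assume "j < dim_vec (0\<^sub>v (card I) :: 'a vec)"
      then have j: "j < card J" using J(2) by simp
      then have "pick J j \<in> Z" using J(1) pick_in_set by blast
      then show "((submatrix Q I J)\<^sup>T *\<^sub>v ?y) $ j = 0\<^sub>v (card I) $ j"
        using j J(2) by (subst submatrix_transpose_mult_vec_index[OF Q IJ x(1)])
          (auto simp: I_def Z_def)
    qed (use sub in simp)
    moreover have "?y \<noteq> 0\<^sub>v (card I)"
    proof
      assume y: "?y = 0\<^sub>v (card I)"
      have "card {a \<in> I. a < i} < card I"
        using i IJ(1) finite_subset by (intro psubset_card_mono) auto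
      then have "?y $ card {a \<in> I. a < i} = x $ i"
        by (simp add: pick_card_in_set[OF i])
      then show False
        using y \<open>card {a \<in> I. a < i} < card I\<close> i by (simp add: I_def)
    qed
    ultimately have "det ((submatrix Q I J)\<^sup>T) = 0"
      using det_0_iff_vec_prod_zero_field[OF transpose_carrier_mat[THEN iffD2, OF sub]]
        vec_carrier[of "card I" "\<lambda>i. x $ pick I i"] by blast
    then have "det (submatrix Q I J) = 0"
      using det_transpose[OF sub] by simp
    then show False
      using reg Q IJ J(2) i unfolding full_superregular_def by (metis carrier_matD empty_iff)
  qed
  then show "card {i. i < k \<and> x $ i = 0} + card {j. j < m \<and> (Q\<^sup>T *\<^sub>v x) $ j = 0} < k"
    using cI by (simp add: Z_def)
next
  assume few: "\<forall>x \<in> carrier_vec k. x \<noteq> 0\<^sub>v k \<longrightarrow>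
      card {i. i < k \<and> x $ i = 0} + card {j. j < m \<and> (Q\<^sup>T *\<^sub>v x) $ j = 0} < k"
  show "full_superregular Q"
    unfolding full_superregular_def
  proof (intro allI impI notI)
    fix I J
    assume "I \<subseteq> {..<dim_row Q} \<and> J \<subseteq> {..<dim_col Q} \<and> I \<noteq> {} \<and> card I = card J"
      and det: "det (submatrix Q I J) = 0"
    then have IJ: "I \<subseteq> {..<k}" "J \<subseteq> {..<m}" "card I = card J" using Q by auto
    then have fin: "finite I" "finite J" using finite_subset by blast+
    have sub: "submatrix Q I J \<in> carrier_mat (card I) (card I)"
      using submatrix_carrier[OF Q IJ(1,2)] IJ(3) by simp
    then obtain y where y: "y \<in> carrier_vec (card I)" "y \<noteq> 0\<^sub>v (card I)"
        "(submatrix Q I J)\<^sup>T *\<^sub>v y = 0\<^sub>v (card I)"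
      using det_0_iff_vec_prod_zero_field[of "(submatrix Q I J)\<^sup>T" "card I"] det
      by (auto simp: det_transpose)
    \<comment> \<open>The kernel vector is spread over the positions in \<open>I\<close>; counting
      the smaller elements of \<open>I\<close> inverts \<open>pick I\<close>.\<close>
    define x where "x = vec k (\<lambda>i. if i \<in> I then y $ card {a \<in> I. a < i} else 0)"
    have pick_I: "pick I i \<in> I" if "i < card I" for i
      using that by (simp add: pick_in_set)
    have x_pick: "x $ pick I i = y $ i" if "i < card I" for i
      using that IJ(1) pick_I[OF that] by (auto simp: x_def card_pick)
    have y_eq: "y = vec (card I) (\<lambda>i. x $ pick I i)"
      using y(1) by (intro eq_vecI) (auto simp: x_pick)
    have x: "x \<in> carrier_vec k" "x \<noteq> 0\<^sub>v k"
    proof -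
      show "x \<in> carrier_vec k" by (simp add: x_def)
      obtain i where "i < card I" "y $ i \<noteq> 0"
        using nonzero_vecE[OF y(1,2)] .
      then show "x \<noteq> 0\<^sub>v k"
        using x_pick pick_I IJ(1) by (metis index_zero_vec(1) lessThan_iff subsetD)
    qed
    have x_zero: "x $ i = 0" if "i < k" "i \<notin> I" for i
      using that by (simp add: x_def)
    have "(Q\<^sup>T *\<^sub>v x) $ j = 0" if "j \<in> J" for j
    proof -
      have "j \<in> pick J ` {..<card J}"
        using bij_betw_imp_surj_on[OF bij_betw_pick[OF fin(2)]] that by simp
      then obtain j' where j': "j' < card J" "j = pick J j'" by blast
      show ?thesis
        using submatrix_transpose_mult_vec_index[OF Q IJ(1,2) x(1) x_zero j'(1), folded y_eq]
          y(3) j' IJ(3) by (simp del: index_mult_mat_vec)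
    qed
    then have "card J \<le> card {j. j < m \<and> (Q\<^sup>T *\<^sub>v x) $ j = 0}"
      using IJ(2) by (intro card_mono) auto
    moreover have "k - card I \<le> card {i. i < k \<and> x $ i = 0}"
    proof -
      have "k - card I = card ({..<k} - I)"
        using IJ(1) fin(1) by (simp add: card_Diff_subset)
      also have "\<dots> \<le> card {i. i < k \<and> x $ i = 0}"
        by (intro card_mono) (auto simp: x_def)
      finally show ?thesis .
    qed
    ultimately show False
      using few x IJ(3) by fastforce
  qed
qed

section \<open>Invertible matrices\<close>

lemma upper_triangular_invertible:
  fixes A :: "'a::field mat"
  assumes "A \<in> carrier_mat n n" "upper_triangular A" "\<And>i. i < n \<Longrightarrow> A $$ (i, i) \<noteq> 0"
  shows "invertible_mat A"
proof -
  have "det A \<noteq> 0"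
    using assms by (auto simp: upper_triangular_imp_det_eq_0_iff[OF assms(1,2)] diag_mat_def)
  then obtain B where "B \<in> carrier_mat n n" "B * A = 1\<^sub>m n"  "A * B = 1\<^sub>m n"
    using det_non_zero_imp_unit[OF assms(1)] by (auto simp: Units_def ring_mat_def)
  then show ?thesis
    using assms(1) by (auto simp: invertible_mat_def inverts_mat_def)
qed

lemma invertible_matE:
  assumes "invertible_mat B" "B \<in> carrier_mat n n"
  obtains B' where "B' \<in> carrier_mat n n" "B * B' = 1\<^sub>m n" "B' * B = 1\<^sub>m n"
proof -
  obtain B' where B': "B * B' = 1\<^sub>m (dim_row B)" "B' * B = 1\<^sub>m (dim_row B')"
    using assms(1) by (auto simp: invertible_mat_def inverts_mat_def)
  \<comment> \<open>\<open>invertible_mat\<close> does not fix the shape of the inverse; it follows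
    from the column numbers of the two products.\<close>
  have "dim_col B' = n" using arg_cong[OF B'(1), of dim_col] assms(2) by simp
  moreover have "dim_row B' = n" using arg_cong[OF B'(2), of dim_col] assms(2) by simp
  ultimately show ?thesis using B' assms(2) by (intro that[of B']) auto
qed

section \<open>Pivot positions of a sequence of vectors\<close>

lemma (in vector_space) in_span_image_sumE:
  assumes "finite I" "y \<in> span (f ` I)"
  obtains c where "y = (\<Sum>i\<in>I. c i *s f i)"
proof -
  \<comment> \<open>Coefficients belong to indices and not to vectors, so \<open>f\<close> may
    repeat values; one index is split off at a time.\<close>
  have "\<exists>c. y = (\<Sum>i\<in>I. c i *s f i)"
    using assms
  proof (induction I arbitrary: y rule: finite_induct)
    case empty
    then show ?case by simp
  next
    case (insert i I)
    then obtain a where "y - a *s f i \<in> span (f ` I)"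
      by (auto simp: span_breakdown_eq)
    then obtain c where c: "y - a *s f i = (\<Sum>j\<in>I. c j *s f j)"
      using insert.IH by blast
    have "(\<Sum>j\<in>I. (c(i := a)) j *s f j) = (\<Sum>j\<in>I. c j *s f j)"
      using insert.hyps by (intro sum.cong) auto
    then have "y = (\<Sum>j\<in>insert i I. (c(i := a)) j *s f j)"
      using c insert.hyps by (simp add: algebra_simps)
    then show ?case by blast
  qed
  then show ?thesis using that by blast
qed

text \<open>These are the pivot positions of Gaussian elimination when \<open>f 0\<close>,
  \<open>f 1\<close>, ... are scanned from left to right.\<close>

definition (in vector_space) new_dirs :: "(nat \<Rightarrow> 'b) \<Rightarrow> nat \<Rightarrow> nat set" where
  "new_dirs f n = {j. j < n \<and> f j \<notin> span (f ` {..<j})}"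

lemma (in vector_space) new_dirs_Suc:
  "new_dirs f (Suc n) =
    (if f n \<in> span (f ` {..<n}) then new_dirs f n else insert n (new_dirs f n))"
  by (auto simp: new_dirs_def less_Suc_eq)

text \<open>An index is skipped only if its vector already lies in the span of the earlier ones, so
  skipping it loses nothing.\<close>

lemma (in vector_space) span_new_dirs: "span (f ` new_dirs f n) = span (f ` {..<n})"
proof (induction n)
  case 0
  then show ?case by (simp add: new_dirs_def)
next
  case (Suc n)
  show ?case
  proof (cases "f n \<in> span (f ` {..<n})")
    case True
    then show ?thesis
      using Suc by (simp add: new_dirs_Suc lessThan_Suc span_redundant)
  next
    case False
    then show ?thesis
      using Suc by (auto simp: new_dirs_Suc lessThan_Suc span_insert)
  qed
qed

text \<open>Each pivot vector lies outside the span of the earlier ones; this keeps the family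
  independent and the new vector distinct from the previous pivots.\<close>

lemma (in vector_space) new_dirs_independent:
  "independent (f ` new_dirs f n) \<and> inj_on f (new_dirs f n)"
proof (induction n)
  case 0
  then show ?case by (simp add: new_dirs_def independent_empty)
next
  case (Suc n)
  show ?case
  proof (cases "f n \<in> span (f ` {..<n})")
    case True
    then show ?thesis using Suc by (simp add: new_dirs_Suc)
  next
    case False
    then have nin: "f n \<notin> span (f ` new_dirs f n)"
      by (simp add: span_new_dirs)
    then have "f n \<notin> f ` new_dirs f n"
      using span_base by blast
    then show ?thesis
      using False Suc nin
      by (auto simp: new_dirs_Suc independent_insertI)
  qed
qed

lemma (in vector_space) card_new_dirs: "card (new_dirs f n) = dim (f ` {..<n})"
proof -
  have "dim (f ` {..<n}) = card (f ` new_dirs f n)"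
    using new_dirs_independent span_new_dirs by (intro dim_eq_card) auto
  then show ?thesis
    using new_dirs_independent[of f n] by (simp add: card_image)
qed

text \<open>Being a pivot depends only on the earlier vectors. Hence a vector that is no pivot is a
  combination of pivots before it, which later makes the clearing matrices upper triangular.\<close>

lemma (in vector_space) new_dirs_Int_lessThan:
  "j \<le> n \<Longrightarrow> new_dirs f n \<inter> {..<j} = new_dirs f j"
  by (auto simp: new_dirs_def)

section \<open>Rank weight as the dimension of a span\<close>

context
  fixes \<iota> :: "'k::field \<Rightarrow> 'a::field" and bs :: "'a list"
  assumes hom: "field_hom \<iota>" and bs: "ordered_basis \<iota> bs"
begin

interpretation V: vector_space "ext_scale \<iota>"
  by (rule vector_space_ext_scale[OF hom])

interpretation W: vec_space "TYPE('k)" "length bs" .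

definition coord_vec :: "'a \<Rightarrow> 'k vec" where
  "coord_vec x = vec (length bs) (\<lambda>i. V.representation (set bs) x (bs ! i))"

lemma bs_indep: "V.independent (set bs)" and bs_span: "V.span (set bs) = UNIV"
  using bs by (simp_all add: ordered_basis_def)

lemma coord_vec_carrier: "coord_vec x \<in> carrier_vec (length bs)"
  by (simp add: coord_vec_def)

lemma coord_vec_index: "i < length bs \<Longrightarrow> coord_vec x $ i = V.representation (set bs) x (bs ! i)"
  by (simp add: coord_vec_def)

lemma coord_vec_inj: "coord_vec x = coord_vec y \<Longrightarrow> x = y"
proof -
  assume eq: "coord_vec x = coord_vec y"
  have "V.representation (set bs) x b = V.representation (set bs) y b" if "b \<in> set bs" for b
    using that eq by (metis coord_vec_index in_set_conv_nth)
  then have "(\<Sum>b\<in>set bs. ext_scale \<iota> (V.representation (set bs) x b) b) =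
      (\<Sum>b\<in>set bs. ext_scale \<iota> (V.representation (set bs) y b) b)"
    by simp
  then show "x = y"
    using bs_span by (simp add: V.sum_representation_eq[OF bs_indep])
qed

lemma coord_vec_zero: "coord_vec 0 = 0\<^sub>v (length bs)"
  by (rule eq_vecI) (simp_all add: coord_vec_def V.representation_zero)

text \<open>Coordinates depend linearly on the element over \<open>F_q\<close>. Injectivity of
  \<open>coord_vec\<close> allows the sum over the image to be reindexed by
  \<open>T\<close>.\<close>

lemma lincomb_coord_vec:
  assumes "finite T"
  shows "W.lincomb a (coord_vec ` T) = coord_vec (\<Sum>t\<in>T. ext_scale \<iota> (a (coord_vec t)) t)"
proof (rule eq_vecI)
  have sub: "coord_vec ` T \<subseteq> carrier_vec (length bs)"
    using coord_vec_carrier by auto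
  show "dim_vec (W.lincomb a (coord_vec ` T)) =
      dim_vec (coord_vec (\<Sum>t\<in>T. ext_scale \<iota> (a (coord_vec t)) t))"
    using W.lincomb_dim[OF _ sub] assms by (simp add: coord_vec_def)
  fix i
  assume "i < dim_vec (coord_vec (\<Sum>t\<in>T. ext_scale \<iota> (a (coord_vec t)) t))"
  then have i: "i < length bs" by (simp add: coord_vec_def)
  have "W.lincomb a (coord_vec ` T) $ i = (\<Sum>x\<in>coord_vec ` T. a x * x $ i)"
    by (rule W.lincomb_index[OF i sub])
  also have "\<dots> = (\<Sum>t\<in>T. a (coord_vec t) * coord_vec t $ i)"
    by (subst sum.reindex) (auto intro: inj_onI coord_vec_inj)
  also have "\<dots> = coord_vec (\<Sum>t\<in>T. ext_scale \<iota> (a (coord_vec t)) t) $ i"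
    using i bs_span
    by (simp add: coord_vec_index V.representation_sum[OF bs_indep] V.representation_scale[OF bs_indep])
  finally show "W.lincomb a (coord_vec ` T) $ i =
      coord_vec (\<Sum>t\<in>T. ext_scale \<iota> (a (coord_vec t)) t) $ i" .
qed

text \<open>Since \<open>coord_vec\<close> is linear and injective, it carries relations among
  elements of \<open>T\<close> to relations with the same coefficients, and back.\<close>

lemma lin_dep_coord_vec:
  assumes "finite T"
  shows "W.lin_dep (coord_vec ` T) \<longleftrightarrow> V.dependent T"
proof
  have sub: "coord_vec ` T \<subseteq> carrier_vec (length bs)"
    using coord_vec_carrier by auto
  assume "W.lin_dep (coord_vec ` T)"
  then obtain a v where a: "W.lincomb a (coord_vec ` T) = 0\<^sub>v (length bs)"
      "v \<in> coord_vec ` T" "a v \<noteq> 0"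
    using W.finite_lin_dep[of "coord_vec ` T"] assms sub by auto
  then have "(\<Sum>t\<in>T. ext_scale \<iota> (a (coord_vec t)) t) = 0"
    using lincomb_coord_vec[OF assms, of a] coord_vec_inj coord_vec_zero by metis
  then show "V.dependent T"
    using a(2,3) by (auto simp: V.dependent_finite[OF assms] intro!: exI[of _ "\<lambda>t. a (coord_vec t)"])
next
  assume "V.dependent T"
  then obtain c t where c: "t \<in> T" "c t \<noteq> 0" "(\<Sum>t\<in>T. ext_scale \<iota> (c t) t) = 0"
    by (auto simp: V.dependent_finite[OF assms])
  \<comment> \<open>Coefficients in \<open>W.lincomb\<close> are functions of the vectors, so
    \<open>c\<close> has to be pulled back along the inverse of \<open>coord_vec\<close>.\<close>
  have inv: "inv_into UNIV coord_vec (coord_vec s) = s" for s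
    by (rule inv_into_f_f) (auto intro: injI coord_vec_inj)
  have "W.lincomb (c \<circ> inv_into UNIV coord_vec) (coord_vec ` T) = 0\<^sub>v (length bs)"
    by (simp add: lincomb_coord_vec[OF assms] inv c(3) coord_vec_zero)
  then show "W.lin_dep (coord_vec ` T)"
    using c(1,2) assms
    by (intro W.lin_dep_crit[where A = "coord_vec ` T" and a = "c \<circ> inv_into UNIV coord_vec"
        and v = "coord_vec t"])
      (auto simp: inv)
qed

text \<open>The rank is the size of a maximal independent set of columns, and
  \<open>coord_vec\<close> maps a basis chosen among the coordinates of \<open>v\<close> to such a
  set. From here on the weight is handled without reference to \<open>bs\<close>.\<close>

lemma rank_weight_eq_dim: "rank_weight \<iota> bs v = V.dim (vec_set v)"
proof -
  have cols: "set (cols (expansion_mat \<iota> bs v)) = coord_vec ` vec_set v"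
  proof -
    have "col (expansion_mat \<iota> bs v) j = coord_vec (v $ j)" if "j < dim_vec v" for j
      using that by (intro eq_vecI) (auto simp: expansion_mat_def coord_vec_def)
    moreover have "dim_col (expansion_mat \<iota> bs v) = dim_vec v"
      by (simp add: expansion_mat_def)
    ultimately show ?thesis
      by (force simp: cols_def vec_set_def)
  qed
  have fin: "finite (vec_set v)" by (simp add: vec_set_def)
  obtain B where B: "B \<subseteq> vec_set v" "V.independent B" "vec_set v \<subseteq> V.span B"
      "card B = V.dim (vec_set v)"
    by (rule V.basis_exists)
  have finB: "finite B" using B(1) fin finite_subset by blast
  have "maximal (coord_vec ` B) (\<lambda>T. T \<subseteq> set (cols (expansion_mat \<iota> bs v)) \<and> W.lin_indpt T)"
    unfolding maximal_def cols
  proof (intro conjI allI impI)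
    show "coord_vec ` B \<subseteq> coord_vec ` vec_set v" using B(1) by blast
    show "W.lin_indpt (coord_vec ` B)" using B(2) finB by (simp add: lin_dep_coord_vec)
  next
    fix T
    assume T: "coord_vec ` B \<subseteq> T \<and> (T \<subseteq> coord_vec ` vec_set v \<and> W.lin_indpt T)"
    then obtain S where S: "S \<subseteq> vec_set v" "T = coord_vec ` S"
      by (auto simp: subset_image_iff)
    have finS: "finite S" using S(1) fin finite_subset by blast
    have BS: "B \<subseteq> S"
      using T S(2) coord_vec_inj by blast
    have "V.independent S"
      using T S(2) finS by (simp add: lin_dep_coord_vec)
    \<comment> \<open>An independent set inside the span of \<open>B\<close> has at most
      \<open>card B\<close> elements, so \<open>S\<close> cannot properly extend
      \<open>B\<close>.\<close>
    then have "card S \<le> card B"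
      using V.independent_span_bound[OF finB, of S] S(1) B(3) by blast
    then have "B = S"
      using BS finS by (simp add: card_seteq)
    then show "T = coord_vec ` B" using S(2) by simp
  qed
  then have "W.rank (expansion_mat \<iota> bs v) = card (coord_vec ` B)"
    by (intro W.rank_card_indpt[where nc = "dim_vec v"]) (simp add: expansion_mat_def)
  also have "\<dots> = card B"
    by (intro card_image inj_onI coord_vec_inj)
  finally show ?thesis
    using B(4) by (simp add: rank_weight_def)
qed

end

section \<open>Operations over the base field on codewords\<close>

context
  fixes \<iota> :: "'k::field \<Rightarrow> 'a::field"
  assumes hom: "field_hom \<iota>"
begin

interpretation field_hom \<iota> by (rule hom)

interpretation V: vector_space "ext_scale \<iota>"
  by (rule vector_space_ext_scale[OF hom])

text \<open>The entries of \<open>N\<close> lie in \<open>F_q\<close>, so every coordinate of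
  \<open>x N\<close> is an \<open>F_q\<close>-combination of coordinates of \<open>x\<close>. This
  is why such operations cannot raise the rank weight.\<close>

lemma vec_set_map_mult_subset_span:
  assumes "N \<in> carrier_mat r c" "x \<in> carrier_vec r"
  shows "vec_set ((map_mat \<iota> N)\<^sup>T *\<^sub>v x) \<subseteq> V.span (vec_set x)"
proof
  fix y assume "y \<in> vec_set ((map_mat \<iota> N)\<^sup>T *\<^sub>v x)"
  then obtain j where j: "j < c" "y = ((map_mat \<iota> N)\<^sup>T *\<^sub>v x) $ j"
    using assms(1) by (auto simp: vec_set_def)
  have y: "y = (\<Sum>i<r. ext_scale \<iota> (N $$ (i, j)) (x $ i))"
    using j assms(1) transpose_mult_vec_index[of "map_mat \<iota> N" r c x j] assms
    by (auto simp: ext_scale_def intro!: sum.cong)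
  show "y \<in> V.span (vec_set x)"
    unfolding y vec_set_carrier[OF assms(2)]
    by (intro V.span_sum V.span_scale V.span_base) auto
qed

text \<open>In row notation this is \<open>(x B) B' = x\<close>, so the identity needed is
  \<open>B * B' = 1\<close>. The undoing matrix is again over \<open>F_q\<close>, so spans are
  controlled in both directions.\<close>

lemma map_mult_left_inverse:
  assumes "invertible_mat B" "B \<in> carrier_mat n n"
  obtains B' where "B' \<in> carrier_mat n n"
    "\<And>x. x \<in> carrier_vec n \<Longrightarrow> (map_mat \<iota> B')\<^sup>T *\<^sub>v ((map_mat \<iota> B)\<^sup>T *\<^sub>v x) = x"
proof -
  obtain B' where B': "B' \<in> carrier_mat n n" "B * B' = 1\<^sub>m n"
    using invertible_matE[OF assms] .
  have "(map_mat \<iota> B')\<^sup>T * (map_mat \<iota> B)\<^sup>T = (map_mat \<iota> (B * B'))\<^sup>T"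
    using assms(2) B'(1)
    by (subst mat_hom_mult[OF assms(2) B'(1)]) (simp add: transpose_mult[where nr = n and n = n and nc = n])
  then have "(map_mat \<iota> B')\<^sup>T * (map_mat \<iota> B)\<^sup>T = 1\<^sub>m n"
    by (simp add: B'(2) mat_hom_one)
  then have "(map_mat \<iota> B')\<^sup>T *\<^sub>v ((map_mat \<iota> B)\<^sup>T *\<^sub>v x) = x" if "x \<in> carrier_vec n" for x
    using that assms(2) B'(1)
    by (subst assoc_mult_mat_vec[symmetric, where n\<^sub>1 = n and n\<^sub>2 = n and n\<^sub>3 = n]) auto
  then show ?thesis using that B'(1) by blast
qed

text \<open>With \<open>u = x B\<close> the right side is \<open>(u P) A + x C\<close>, which ties
  \<open>(x, x Q)\<close> to the codeword \<open>(u, u P)\<close> through matrices over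
  \<open>F_q\<close> only.\<close>

lemma transpose_combination_mult_vec:
  assumes "P \<in> carrier_mat k m" "B \<in> carrier_mat k k" "A \<in> carrier_mat m m"
    "C \<in> carrier_mat k m" "x \<in> carrier_vec k"
  shows "(map_mat \<iota> B * P * map_mat \<iota> A + map_mat \<iota> C)\<^sup>T *\<^sub>v x =
    (map_mat \<iota> A)\<^sup>T *\<^sub>v (P\<^sup>T *\<^sub>v ((map_mat \<iota> B)\<^sup>T *\<^sub>v x)) + (map_mat \<iota> C)\<^sup>T *\<^sub>v x"
proof -
  let ?B = "map_mat \<iota> B" and ?A = "map_mat \<iota> A" and ?C = "map_mat \<iota> C"
  have c: "?B \<in> carrier_mat k k" "?A \<in> carrier_mat m m" "?C \<in> carrier_mat k m"
    using assms by auto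
  have "(?B * P * ?A)\<^sup>T = ?A\<^sup>T * (P\<^sup>T * ?B\<^sup>T)"
    using c assms(1)
    by (simp add: transpose_mult[where nr = k and n = m and nc = m]
      transpose_mult[where nr = k and n = k and nc = m])
  moreover have "(?B * P * ?A + ?C)\<^sup>T = (?B * P * ?A)\<^sup>T + ?C\<^sup>T"
    using c assms(1) by (intro transpose_add) auto
  moreover have "(?A\<^sup>T * (P\<^sup>T * ?B\<^sup>T)) *\<^sub>v x = ?A\<^sup>T *\<^sub>v (P\<^sup>T *\<^sub>v (?B\<^sup>T *\<^sub>v x))"
    using c assms(1,5)
    by (simp add: assoc_mult_mat_vec[where n\<^sub>1 = m and n\<^sub>2 = m and n\<^sub>3 = k]
      assoc_mult_mat_vec[where n\<^sub>1 = m and n\<^sub>2 = k and n\<^sub>3 = k])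
  moreover have "(?A\<^sup>T * (P\<^sup>T * ?B\<^sup>T) + ?C\<^sup>T) *\<^sub>v x = (?A\<^sup>T * (P\<^sup>T * ?B\<^sup>T)) *\<^sub>v x + ?C\<^sup>T *\<^sub>v x"
    using c assms(1,5) by (intro add_mult_distrib_mat_vec[where nr = m and nc = k]) auto
  ultimately show ?thesis by simp
qed

text \<open>At least \<open>k\<close> zeros among the \<open>k + m\<close> coordinates of
  \<open>(x, x Q)\<close> leave at most \<open>m\<close> nonzero ones. Their span contains the
  coordinates of \<open>u = x B\<close> and of \<open>u P\<close>, the latter recovered as
  \<open>x Q - x C\<close> multiplied by the inverse of \<open>A\<close>.\<close>

lemma dim_le_of_many_zeros:
  assumes P: "P \<in> carrier_mat k m" and B: "B \<in> carrier_mat k k"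
    and A: "A \<in> carrier_mat m m" "invertible_mat A"
    and C: "C \<in> carrier_mat k m" and x: "x \<in> carrier_vec k"
    and Q: "Q = map_mat \<iota> B * P * map_mat \<iota> A + map_mat \<iota> C"
    and zeros: "k \<le> card {i. i < k \<and> x $ i = 0} + card {j. j < m \<and> (Q\<^sup>T *\<^sub>v x) $ j = 0}"
    and u: "u = (map_mat \<iota> B)\<^sup>T *\<^sub>v x"
  shows "V.dim (vec_set (u @\<^sub>v (P\<^sup>T *\<^sub>v u))) \<le> m"
proof -
  let ?y = "Q\<^sup>T *\<^sub>v x" and ?w = "P\<^sup>T *\<^sub>v u"
  let ?I = "{i. i < k \<and> x $ i \<noteq> 0}" and ?J = "{j. j < m \<and> ?y $ j \<noteq> 0}"
  \<comment> \<open>\<open>S\<close> collects the nonzero coordinates of \<open>(x, x Q)\<close>;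
    the zero ones lie in every span.\<close>
  define S where "S = ($) x ` ?I \<union> ($) ?y ` ?J"
  have carr: "u \<in> carrier_vec k" "?w \<in> carrier_vec m" "?y \<in> carrier_vec m"
    using P B C by (auto simp: u Q intro!: transpose_mult_vec_carrier)
  have "card ({..<k} - ?I) = k - card ?I" "card ({..<m} - ?J) = m - card ?J"
    by (subst card_Diff_subset; auto)+
  moreover have "{..<k} - ?I = {i. i < k \<and> x $ i = 0}" "{..<m} - ?J = {j. j < m \<and> ?y $ j = 0}"
    by auto
  moreover have "card ?I \<le> card {..<k}" "card ?J \<le> card {..<m}"
    by (intro card_mono; auto)+
  ultimately have "card ?I + card ?J \<le> m"
    using zeros by simp
  moreover have "card S \<le> card ?I + card ?J"
    unfolding S_def by (intro order.trans[OF card_Un_le] add_mono card_image_le) auto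
  ultimately have card_S: "card S \<le> m" by linarith
  have x_span: "vec_set x \<subseteq> V.span S"
  proof
    fix a assume "a \<in> vec_set x"
    then obtain i where "i < k" "a = x $ i" using x by (auto simp: vec_set_def)
    then show "a \<in> V.span S"
      by (cases "a = 0") (auto simp: S_def V.span_zero intro!: V.span_base)
  qed
  have y_span: "vec_set ?y \<subseteq> V.span S"
  proof
    fix a assume "a \<in> vec_set ?y"
    then obtain j where "j < m" "a = ?y $ j"
      unfolding vec_set_carrier[OF carr(3)] by blast
    then show "a \<in> V.span S"
      by (cases "a = 0") (auto simp: S_def V.span_zero intro!: V.span_base)
  qed
  have minimal: "V.span T \<subseteq> V.span S" if "T \<subseteq> V.span S" for T
    using that by (intro V.span_minimal V.subspace_span)
  have u_span: "vec_set u \<subseteq> V.span S"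
    using vec_set_map_mult_subset_span[OF B x] minimal[OF x_span] by (auto simp: u)
  let ?c = "(map_mat \<iota> C)\<^sup>T *\<^sub>v x" and ?z = "(map_mat \<iota> A)\<^sup>T *\<^sub>v ?w"
  have c_span: "vec_set ?c \<subseteq> V.span S"
    using vec_set_map_mult_subset_span[OF C x] minimal[OF x_span] by auto
  have yz: "?y = ?z + ?c"
    unfolding Q u by (rule transpose_combination_mult_vec[OF P B A(1) C x])
  have carr_c: "?c \<in> carrier_vec m" "?z \<in> carrier_vec m"
    using A C by (auto intro!: transpose_mult_vec_carrier)
  have z_span: "vec_set ?z \<subseteq> V.span S"
  proof
    fix a assume "a \<in> vec_set ?z"
    then obtain j where j: "j < m" "a = ?z $ j"
      unfolding vec_set_carrier[OF carr_c(2)] by blast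
    then have "a = ?y $ j - ?c $ j"
      using C by (simp add: yz del: index_mult_mat_vec)
    moreover have "?y $ j \<in> vec_set ?y" "?c $ j \<in> vec_set ?c"
      using j(1) by (auto simp only: vec_set_carrier[OF carr(3)] vec_set_carrier[OF carr_c(1)])
    ultimately show "a \<in> V.span S"
      using y_span c_span by (auto intro!: V.span_diff)
  qed
  \<comment> \<open>Undoing \<open>A\<close> over \<open>F_q\<close> brings \<open>(u P) A\<close>
    back to \<open>u P\<close> without leaving the span of \<open>S\<close>.\<close>
  obtain A' where "A' \<in> carrier_mat m m" "(map_mat \<iota> A')\<^sup>T *\<^sub>v ?z = ?w"
    using map_mult_left_inverse[OF A(2,1)] carr(2) by metis
  then have "vec_set ?w \<subseteq> V.span S"
    using vec_set_map_mult_subset_span[of A' m m ?z] carr_c(2) minimal[OF z_span] by auto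
  then have "V.dim (vec_set (u @\<^sub>v ?w)) \<le> card S"
    using u_span by (intro V.dim_le_card) (auto simp: vec_set_append_vec S_def)
  then show ?thesis using card_S by linarith
qed

text \<open>The coordinates of \<open>(u, u P)\<close> outside \<open>N\<close> are cleared. The clearing operation has the blocks
  \<open>B\<^sup>-\<^sup>1\<close>, \<open>B\<^sup>-\<^sup>1 C\<close>, \<open>A\<close>; no inverse has to be computed because every cleared
  coordinate is a combination of coordinates in \<open>N\<close>, which are kept, so \<open>u = x B\<close> can be read off.\<close>

lemma many_zeros_of_dim_le:
  assumes P: "P \<in> carrier_mat k m" and u: "u \<in> carrier_vec k"
    and dim: "V.dim (vec_set (u @\<^sub>v (P\<^sup>T *\<^sub>v u))) \<le> m"
  obtains A B C x Q where "B \<in> carrier_mat k k" "invertible_mat B" "upper_triangular B"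
    and "A \<in> carrier_mat m m" "invertible_mat A" "upper_triangular A"
    and "C \<in> carrier_mat k m" and "x \<in> carrier_vec k"
    and "Q = map_mat \<iota> B * P * map_mat \<iota> A + map_mat \<iota> C"
    and "k \<le> card {i. i < k \<and> x $ i = 0} + card {j. j < m \<and> (Q\<^sup>T *\<^sub>v x) $ j = 0}"
    and "u = (map_mat \<iota> B)\<^sup>T *\<^sub>v x"
proof -
  define w where "w = P\<^sup>T *\<^sub>v u"
  define f where "f = ($) (u @\<^sub>v w)"
  \<comment> \<open>The pivots among the coordinates of \<open>(u, u P)\<close>; there are at most
    \<open>m\<close> by assumption.\<close>
  define N where "N = V.new_dirs f (k + m)"
  have w: "w \<in> carrier_vec m" using P by (simp add: w_def transpose_mult_vec_carrier)
  have f_u: "f i = u $ i" if "i < k" for i using that u by (simp add: f_def)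
  have f_w: "f (k + j) = w $ j" if "j < m" for j using that u w by (simp add: f_def)
  have "card N = V.dim (f ` {..<k + m})"
    unfolding N_def by (rule V.card_new_dirs)
  also have "f ` {..<k + m} = vec_set (u @\<^sub>v w)"
    using u w by (simp add: vec_set_def f_def)
  finally have card_N: "card N \<le> m"
    using dim by (simp add: w_def)
  have N_sub: "N \<subseteq> {..<k + m}" by (auto simp: N_def V.new_dirs_def)
  have "\<exists>c. f j = (\<Sum>i\<in>N \<inter> {..<j}. ext_scale \<iota> (c i) (f i))" if "j < k + m" "j \<notin> N" for j
  proof -
    have "f j \<in> V.span (f ` (N \<inter> {..<j}))"
      using that V.new_dirs_Int_lessThan[of j "k + m" f] V.span_new_dirs[of f j]
      by (auto simp: N_def V.new_dirs_def)
    then show ?thesis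
      by (rule V.in_span_image_sumE[rotated]) auto
  qed
  \<comment> \<open>\<open>c j i\<close> is the coefficient of pivot \<open>i\<close> in the
    expansion of the non-pivot coordinate \<open>j\<close>; only pivots before \<open>j\<close>
    occur.\<close>
  then obtain c where c: "f j = (\<Sum>i\<in>N \<inter> {..<j}. \<iota> (c j i) * f i)" if "j < k + m" "j \<notin> N" for j
    unfolding ext_scale_def by metis
  define x where "x = vec k (\<lambda>i. if i \<in> N then u $ i else 0)"
  \<comment> \<open>A non-pivot column \<open>j\<close> of \<open>B\<close> rebuilds
    \<open>u $ j\<close> from the pivots kept in \<open>x\<close>. Its diagonal one meets
    \<open>x $ j = 0\<close> and serves invertibility alone.\<close>
  define B where "B = mat k k (\<lambda>(i, j). if i = j then 1 else if i < j \<and> i \<in> N \<and> j \<notin> N then c j i else 0)"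
  \<comment> \<open>To clear coordinate \<open>k + j\<close>, \<open>A\<close> subtracts the
    contribution of the pivots in \<open>u P\<close> and \<open>C\<close> that of the pivots in
    \<open>u\<close>; hence the minus signs. Pivot columns remain unchanged.\<close>
  define A where "A = mat m m (\<lambda>(i, j). if i = j then 1
    else if i < j \<and> k + i \<in> N \<and> k + j \<notin> N then - c (k + j) (k + i) else 0)"
  define C where "C = mat k m (\<lambda>(i, j). if i \<in> N \<and> k + j \<notin> N then - c (k + j) i else 0)"
  have carr: "B \<in> carrier_mat k k" "A \<in> carrier_mat m m" "C \<in> carrier_mat k m" "x \<in> carrier_vec k"
    by (simp_all add: B_def A_def C_def x_def)
  have tri: "upper_triangular B" "upper_triangular A"
    by (auto simp: B_def A_def)
  have inv: "invertible_mat B" "invertible_mat A"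
    using upper_triangular_invertible[OF carr(1) tri(1)] upper_triangular_invertible[OF carr(2) tri(2)]
    by (simp_all add: B_def A_def)
  have xB: "u = (map_mat \<iota> B)\<^sup>T *\<^sub>v x"
  proof (rule eq_vecI)
    fix j assume "j < dim_vec ((map_mat \<iota> B)\<^sup>T *\<^sub>v x)"
    then have j: "j < k" using carr(1) by simp
    have "((map_mat \<iota> B)\<^sup>T *\<^sub>v x) $ j = (\<Sum>i<k. \<iota> (B $$ (i, j)) * x $ i)"
      using j carr by (subst transpose_mult_vec_index[where k = k and m = k]) auto
    also have "\<dots> = u $ j"
    proof (cases "j \<in> N")
      case True
      have "(\<Sum>i<k. \<iota> (B $$ (i, j)) * x $ i) = (\<Sum>i<k. if i = j then u $ i else 0)"
        using j True by (intro sum.cong) (auto simp: B_def x_def)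
      then show ?thesis using j by simp
    next
      case False
      have "(\<Sum>i<k. \<iota> (B $$ (i, j)) * x $ i) = (\<Sum>i\<in>N \<inter> {..<j}. \<iota> (c j i) * f i)"
        using j False by (intro sum.mono_neutral_cong_right) (auto simp: B_def x_def f_u)
      then show ?thesis using c[of j] j False by (simp add: f_u)
    qed
    finally show "u $ j = ((map_mat \<iota> B)\<^sup>T *\<^sub>v x) $ j" ..
  qed (use u carr in auto)
  define Q where "Q = map_mat \<iota> B * P * map_mat \<iota> A + map_mat \<iota> C"
  have Qx: "Q\<^sup>T *\<^sub>v x = (map_mat \<iota> A)\<^sup>T *\<^sub>v w + (map_mat \<iota> C)\<^sup>T *\<^sub>v x"
    unfolding Q_def w_def by (subst transpose_combination_mult_vec[OF P carr]) (simp flip: xB)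
  have zero: "(Q\<^sup>T *\<^sub>v x) $ j = 0" if j: "j < m" "k + j \<notin> N" for j
  proof -
    \<comment> \<open>The pivots before \<open>k + j\<close> lie either in the first block, where
      \<open>C\<close> acts, or in the second, where \<open>A\<close> acts; the shift by
      \<open>k\<close> translates positions.\<close>
    have split: "N \<inter> {..<k + j} = (N \<inter> {..<k}) \<union> (+) k ` {i. i < j \<and> k + i \<in> N}"
      (is "_ = _ \<union> ?K")
    proof (intro subset_antisym subsetI)
      fix i assume "i \<in> N \<inter> {..<k + j}"
      then show "i \<in> (N \<inter> {..<k}) \<union> ?K"
        by (cases "i < k") (auto simp: not_less image_iff intro!: exI[of _ "i - k"])
    qed auto
    have "((map_mat \<iota> A)\<^sup>T *\<^sub>v w) $ j = (\<Sum>i<m. \<iota> (A $$ (i, j)) * w $ i)"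
      using j carr w by (subst transpose_mult_vec_index[where k = m and m = m]) auto
    also have "\<dots> = w $ j + (\<Sum>i\<in>{..<m} - {j}. \<iota> (A $$ (i, j)) * w $ i)"
      using j by (subst sum.remove[of _ j]) (auto simp: A_def)
    also have "(\<Sum>i\<in>{..<m} - {j}. \<iota> (A $$ (i, j)) * w $ i) =
        (\<Sum>i | i < j \<and> k + i \<in> N. - (\<iota> (c (k + j) (k + i)) * f (k + i)))"
      using j by (intro sum.mono_neutral_cong_right) (auto simp: A_def f_w hom_uminus)
    also have "\<dots> = - (\<Sum>i\<in>?K. \<iota> (c (k + j) i) * f i)"
      by (subst sum.reindex) (auto simp: sum_negf)
    finally have 1: "((map_mat \<iota> A)\<^sup>T *\<^sub>v w) $ j = w $ j - (\<Sum>i\<in>?K. \<iota> (c (k + j) i) * f i)"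
      by simp
    have "((map_mat \<iota> C)\<^sup>T *\<^sub>v x) $ j = (\<Sum>i<k. \<iota> (C $$ (i, j)) * x $ i)"
      using j carr by (subst transpose_mult_vec_index[where k = k and m = m]) auto
    also have "\<dots> = (\<Sum>i\<in>N \<inter> {..<k}. - (\<iota> (c (k + j) i) * f i))"
      using j by (intro sum.mono_neutral_cong_right) (auto simp: C_def x_def f_u hom_uminus)
    finally have 2: "((map_mat \<iota> C)\<^sup>T *\<^sub>v x) $ j = - (\<Sum>i\<in>N \<inter> {..<k}. \<iota> (c (k + j) i) * f i)"
      by (simp add: sum_negf)
    have "w $ j = (\<Sum>i\<in>N \<inter> {..<k}. \<iota> (c (k + j) i) * f i) + (\<Sum>i\<in>?K. \<iota> (c (k + j) i) * f i)"
      using c[of "k + j"] j by (simp add: f_w split) (subst sum.union_disjoint; auto)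
    then show ?thesis
      using j carr w by (simp add: Qx 1 2 del: index_mult_mat_vec)
  qed
  \<comment> \<open>There are at least \<open>k\<close> non-pivot positions, and each is a zero of
    \<open>x\<close> or, after the shift by \<open>k\<close>, of \<open>x Q\<close>.\<close>
  have "k \<le> card ({..<k + m} - N)"
    using card_N N_sub finite_subset[OF N_sub] by (simp add: card_Diff_subset)
  also have "\<dots> \<le> card ({i. i < k \<and> x $ i = 0} \<union> (+) k ` {j. j < m \<and> (Q\<^sup>T *\<^sub>v x) $ j = 0})"
  proof (intro card_mono subsetI)
    fix i assume i: "i \<in> {..<k + m} - N"
    show "i \<in> {i. i < k \<and> x $ i = 0} \<union> (+) k ` {j. j < m \<and> (Q\<^sup>T *\<^sub>v x) $ j = 0}"
    proof (cases "i < k")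
      case True
      then show ?thesis using i by (simp add: x_def)
    next
      case False
      then have "i = k + (i - k)" "i - k < m" using i by auto
      then show ?thesis using zero[of "i - k"] i by (metis (mono_tags, lifting) DiffD2 UnI2 imageI mem_Collect_eq)
    qed
  qed simp
  also have "\<dots> \<le> card {i. i < k \<and> x $ i = 0} + card {j. j < m \<and> (Q\<^sup>T *\<^sub>v x) $ j = 0}"
    by (intro order.trans[OF card_Un_le] add_mono card_image_le order.refl) simp
  finally show ?thesis
    using that[OF carr(1) inv(1) tri(1) carr(2) inv(2) tri(2) carr(3,4) Q_def _ xB] by blast
qed

end

section \<open>Systematic codes and the MRD criterion\<close>

lemma systematic_encoder_carrier:
  "P \<in> carrier_mat k m \<Longrightarrow> systematic_encoder k P \<in> carrier_mat k (k + m)"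
  unfolding systematic_encoder_def using four_block_carrier_mat[of "1\<^sub>m k" k k "0\<^sub>m 0 (dim_col P)" 0 m] by simp

lemma systematic_encoder_mult_vec:
  fixes P :: "'a::comm_ring_1 mat"
  assumes P: "P \<in> carrier_mat k m" and u: "u \<in> carrier_vec k"
  shows "(systematic_encoder k P)\<^sup>T *\<^sub>v u = u @\<^sub>v (P\<^sup>T *\<^sub>v u)"
proof (rule eq_vecI)
  note G = systematic_encoder_carrier[OF P]
  show "dim_vec ((systematic_encoder k P)\<^sup>T *\<^sub>v u) = dim_vec (u @\<^sub>v (P\<^sup>T *\<^sub>v u))"
    using G P u by simp
  fix j assume "j < dim_vec (u @\<^sub>v (P\<^sup>T *\<^sub>v u))"
  then have j: "j < k + m" using P u by simp
  have G_index: "systematic_encoder k P $$ (i, j) =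
      (if j < k then if i = j then 1 else 0 else P $$ (i, j - k))" if "i < k" for i
    using that P j by (simp add: systematic_encoder_def)
  have "((systematic_encoder k P)\<^sup>T *\<^sub>v u) $ j = (\<Sum>i<k. systematic_encoder k P $$ (i, j) * u $ i)"
    by (rule transpose_mult_vec_index[OF G u j])
  also have "\<dots> = (u @\<^sub>v (P\<^sup>T *\<^sub>v u)) $ j"
  proof (cases "j < k")
    case True
    have "(\<Sum>i<k. systematic_encoder k P $$ (i, j) * u $ i) = (\<Sum>i<k. if i = j then u $ i else 0)"
      using True by (intro sum.cong) (auto simp: G_index)
    then show ?thesis using True u by simp
  next
    case False
    have "(\<Sum>i<k. systematic_encoder k P $$ (i, j) * u $ i) = (\<Sum>i<k. P $$ (i, j - k) * u $ i)"
      using False by (intro sum.cong) (auto simp: G_index)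
    also have "\<dots> = (P\<^sup>T *\<^sub>v u) $ (j - k)"
      using False j by (intro transpose_mult_vec_index[OF P u, symmetric]) auto
    finally show ?thesis using False u j P by simp
  qed
  finally show "((systematic_encoder k P)\<^sup>T *\<^sub>v u) $ j = (u @\<^sub>v (P\<^sup>T *\<^sub>v u)) $ j" .
qed

lemma append_vec_eq_zero_iff:
  fixes u w :: "'a::zero vec"
  shows "u \<in> carrier_vec k \<Longrightarrow> w \<in> carrier_vec m \<Longrightarrow>
    u @\<^sub>v w = 0\<^sub>v (k + m) \<longleftrightarrow> u = 0\<^sub>v k \<and> w = 0\<^sub>v m"
proof -
  assume uw: "u \<in> carrier_vec k" "w \<in> carrier_vec m"
  have "0\<^sub>v (k + m) = (0\<^sub>v k @\<^sub>v 0\<^sub>v m :: 'a vec)"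
    by (intro eq_vecI) auto
  then show ?thesis
    using append_vec_eq[OF uw(1) zero_carrier_vec, of w "0\<^sub>v m"] by simp
qed

lemma code_of_systematic_encoder:
  fixes P :: "'a::comm_ring_1 mat"
  assumes "P \<in> carrier_mat k m"
  shows "code_of (systematic_encoder k P) = {u @\<^sub>v (P\<^sup>T *\<^sub>v u) | u. u \<in> carrier_vec k}"
proof -
  have "dim_row (systematic_encoder k P) = k"
    using systematic_encoder_carrier[OF assms] by simp
  then show ?thesis
    unfolding code_of_def using systematic_encoder_mult_vec[OF assms] by (metis (no_types, lifting))
qed

lemma code_of_eq_col_space:
  fixes G :: "'a::field mat"
  assumes "G \<in> carrier_mat k n"
  shows "code_of G = LinearCombinations.module.span class_ring (module_vec TYPE('a) n) (set (cols G\<^sup>T))"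
proof -
  interpret W: vec_space "TYPE('a)" n .
  have "code_of G = W.col_space G\<^sup>T"
    using assms by (subst W.col_space_eq[of _ k]) (auto simp: code_of_def)
  then show ?thesis by (simp add: W.col_space_def)
qed

lemma linear_code_code_of:
  fixes G :: "'a::field mat"
  assumes "G \<in> carrier_mat k n"
  shows "linear_code n (code_of G)"
proof -
  interpret W: vec_space "TYPE('a)" n .
  have "set (cols G\<^sup>T) \<subseteq> carrier_vec n"
    using assms cols_dim[of "G\<^sup>T"] by simp
  then show ?thesis
    unfolding linear_code_def code_of_eq_col_space[OF assms]
    by (intro W.span_is_subspace) simp
qed

text \<open>The identity block makes \<open>u\<close> a prefix of its codeword, so no nonzero
  \<open>u\<close> is sent to zero and the \<open>k\<close> rows of the encoder are
  independent.\<close>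

lemma code_dim_systematic_encoder:
  fixes P :: "'a::field mat"
  assumes P: "P \<in> carrier_mat k m"
  shows "code_dim (k + m) (code_of (systematic_encoder k P)) = k"
proof -
  let ?G = "systematic_encoder k P"
  note G = systematic_encoder_carrier[OF P]
  interpret W: vec_space "TYPE('a)" "k + m" .
  have GT: "?G\<^sup>T \<in> carrier_mat (k + m) k" using G by simp
  \<comment> \<open>Independence concerns the set of columns, so repetitions must be excluded first:
    columns \<open>i\<close> and \<open>j\<close> differ at position \<open>i\<close> of the
    identity block.\<close>
  have dist: "distinct (cols ?G\<^sup>T)"
    unfolding distinct_conv_nth
  proof (intro allI impI)
    fix i j assume ij: "i < length (cols ?G\<^sup>T)" "j < length (cols ?G\<^sup>T)" "i \<noteq> j"
    then have "i < k" "j < k" using G by auto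
    then have "col ?G\<^sup>T i $ i \<noteq> col ?G\<^sup>T j $ i"
      using ij(3) G P by (simp add: systematic_encoder_def)
    then show "cols ?G\<^sup>T ! i \<noteq> cols ?G\<^sup>T ! j" using ij by auto
  qed
  have "W.lin_indpt (set (cols ?G\<^sup>T))"
  proof
    assume "W.lin_dep (set (cols ?G\<^sup>T))"
    then obtain v where v: "v \<in> carrier_vec k" "v \<noteq> 0\<^sub>v k" "?G\<^sup>T *\<^sub>v v = 0\<^sub>v (k + m)"
      using W.lin_depE[OF GT _ dist] by blast
    then show False
      using transpose_mult_vec_carrier[OF P]
      by (simp add: systematic_encoder_mult_vec[OF P] append_vec_eq_zero_iff[of _ k _ m])
  qed
  then have "W.rank ?G\<^sup>T = k"
    by (rule W.lin_indpt_full_rank[OF GT dist])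
  then show ?thesis
    by (simp add: code_dim_def code_of_eq_col_space[OF G] W.rank_def)
qed

text \<open>The required distance is \<open>m + 1\<close>. Some nonzero codeword has weight at most
  \<open>m + 1\<close>, so the minimum equals this value as soon as no nonzero codeword has weight
  \<open>m\<close> or less.\<close>

lemma is_MRD_systematic_encoder_iff:
  fixes \<iota> :: "'k::field \<Rightarrow> 'a::field"
  assumes hom: "field_hom \<iota>" and bs: "ordered_basis \<iota> bs"
    and P: "P \<in> carrier_mat k m" and k: "1 \<le> k"
  shows "is_MRD \<iota> bs (k + m) (code_of (systematic_encoder k P)) \<longleftrightarrow>
    (\<forall>u \<in> carrier_vec k. u \<noteq> 0\<^sub>v k \<longrightarrow>
      m < vector_space.dim (ext_scale \<iota>) (vec_set (u @\<^sub>v (P\<^sup>T *\<^sub>v u))))"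
proof -
  interpret V: vector_space "ext_scale \<iota>"
    by (rule vector_space_ext_scale[OF hom])
  define D where "D = {V.dim (vec_set (u @\<^sub>v (P\<^sup>T *\<^sub>v u))) | u. u \<in> carrier_vec k \<and> u \<noteq> 0\<^sub>v k}"
  have nz: "u @\<^sub>v (P\<^sup>T *\<^sub>v u) \<noteq> 0\<^sub>v (k + m) \<longleftrightarrow> u \<noteq> 0\<^sub>v k" if "u \<in> carrier_vec k" for u
    using that P transpose_mult_vec_carrier[OF P, of u]
    by (subst append_vec_eq_zero_iff[where k = k and m = m]) auto
  have "rank_weight \<iota> bs ` {v \<in> code_of (systematic_encoder k P). v \<noteq> 0\<^sub>v (k + m)} = D"
    unfolding rank_weight_eq_dim[OF hom bs, abs_def] code_of_systematic_encoder[OF P] D_def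
    using nz by blast
  then have MRD: "is_MRD \<iota> bs (k + m) (code_of (systematic_encoder k P)) \<longleftrightarrow> Min D = m + 1"
    using linear_code_code_of[OF systematic_encoder_carrier[OF P]]
    by (simp add: is_MRD_def min_rank_distance_def code_dim_systematic_encoder[OF P])
  \<comment> \<open>The fields are arbitrary here, so finiteness of \<open>D\<close>, on which
    \<open>Min\<close> relies, comes from bounding weights by the length.\<close>
  have "D \<subseteq> {..k + m}"
  proof
    fix d assume "d \<in> D"
    then obtain u where u: "u \<in> carrier_vec k" "d = V.dim (vec_set (u @\<^sub>v (P\<^sup>T *\<^sub>v u)))"
      by (auto simp: D_def)
    have "d \<le> card (vec_set (u @\<^sub>v (P\<^sup>T *\<^sub>v u)))"
      unfolding u(2) by (intro V.dim_le_card') (simp add: vec_set_def)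
    also have "\<dots> \<le> k + m"
      using u(1) P card_image_le[of "{..<k + m}" "($) (u @\<^sub>v (P\<^sup>T *\<^sub>v u))"]
      by (simp add: vec_set_def)
    finally show "d \<in> {..k + m}" by simp
  qed
  then have fin: "finite D" using finite_subset by blast
  have "\<exists>d\<in>D. d \<le> m + 1"
  proof -
    \<comment> \<open>The codeword of a unit vector is a row of the encoder: its coordinates are
      zeros, a one and \<open>m\<close> entries of \<open>P\<close>, spanned by at most
      \<open>m + 1\<close> elements.\<close>
    define u :: "'a vec" where "u = unit_vec k 0"
    have u: "u \<in> carrier_vec k" "u \<noteq> 0\<^sub>v k"
      using k by (auto simp: u_def vec_eq_iff unit_vec_def)
    have "vec_set u \<subseteq> {0, 1}"
      by (auto simp: u_def vec_set_def unit_vec_def)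
    moreover have "{0, 1} \<union> vec_set (P\<^sup>T *\<^sub>v u) \<subseteq> V.span (insert 1 (vec_set (P\<^sup>T *\<^sub>v u)))"
      by (auto simp: V.span_zero intro!: V.span_base)
    ultimately have "vec_set (u @\<^sub>v (P\<^sup>T *\<^sub>v u)) \<subseteq> V.span (insert 1 (vec_set (P\<^sup>T *\<^sub>v u)))"
      unfolding vec_set_append_vec by blast
    then have "V.dim (vec_set (u @\<^sub>v (P\<^sup>T *\<^sub>v u))) \<le> card (insert 1 (vec_set (P\<^sup>T *\<^sub>v u)))"
      by (intro V.dim_le_card) (auto simp: vec_set_def)
    also have "\<dots> \<le> Suc (card (vec_set (P\<^sup>T *\<^sub>v u)))"
      by (rule card_insert_le_m1[of "Suc _", simplified]) simp
    also have "card (vec_set (P\<^sup>T *\<^sub>v u)) \<le> m"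
      using P card_image_le[of "{..<m}" "($) (P\<^sup>T *\<^sub>v u)"] by (simp add: vec_set_def)
    finally have "V.dim (vec_set (u @\<^sub>v (P\<^sup>T *\<^sub>v u))) \<le> m + 1" by simp
    then show ?thesis using u by (auto simp: D_def)
  qed
  then obtain d where d: "d \<in> D" "d \<le> m + 1" by blast
  have "Min D = m + 1 \<longleftrightarrow> (\<forall>d\<in>D. m < d)"
  proof
    assume "Min D = m + 1"
    then show "\<forall>d\<in>D. m < d"
      using Min_le[OF fin] by fastforce
  next
    assume "\<forall>d\<in>D. m < d"
    moreover have "Min D \<in> D" using d fin by (intro Min_in) auto
    moreover have "Min D \<le> m + 1" using Min_le[OF fin d(1)] d(2) by linarith
    ultimately show "Min D = m + 1" by fastforce
  qed
  then show ?thesis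
    unfolding MRD by (auto simp: D_def)
qed

section \<open>MRD codes and full superregular transforms of \<open>P\<close>\<close>

theorem theorem4:
  fixes \<iota> :: "'k::{field,finite} \<Rightarrow> 'a::{field,finite}"
    and bs :: "'a list"
    and q M k n :: nat
    and P :: "'a mat"
  assumes "primepow q" and "M \<ge> 1"
    and "CARD('k) = q" and "CARD('a) = q ^ M"
    and "field_hom \<iota>"
    and "ordered_basis \<iota> bs" and "length bs = M"
    and "1 \<le> k" and "k < n"
    and "P \<in> carrier_mat k (n - k)"
  shows "is_MRD \<iota> bs n (code_of (systematic_encoder k P)) \<longleftrightarrow>
    (\<forall>C \<in> carrier_mat k (n - k). \<forall>B \<in> carrier_mat k k. \<forall>A \<in> carrier_mat (n - k) (n - k).
       invertible_mat B \<and> upper_triangular B \<and> invertible_mat A \<and> upper_triangular A \<longrightarrow>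
       full_superregular (map_mat \<iota> B * P * map_mat \<iota> A + map_mat \<iota> C))"
proof -
  define m where "m = n - k"
  have n: "n = k + m" using assms(9) by (simp add: m_def)
  have P: "P \<in> carrier_mat k m" using assms(10) by (simp add: m_def)
  note hom = assms(5)
  let ?dim = "\<lambda>u. vector_space.dim (ext_scale \<iota>) (vec_set (u @\<^sub>v (P\<^sup>T *\<^sub>v u)))"
  have "(\<forall>u \<in> carrier_vec k. u \<noteq> 0\<^sub>v k \<longrightarrow> m < ?dim u) \<longleftrightarrow>
    (\<forall>C \<in> carrier_mat k m. \<forall>B \<in> carrier_mat k k. \<forall>A \<in> carrier_mat m m.
       invertible_mat B \<and> upper_triangular B \<and> invertible_mat A \<and> upper_triangular A \<longrightarrow>
       full_superregular (map_mat \<iota> B * P * map_mat \<iota> A + map_mat \<iota> C))"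
    (is "?large \<longleftrightarrow> ?regular")
  proof
    assume large: ?large
    show ?regular
    proof (intro ballI impI)
      fix C B A :: "'k mat"
      assume C: "C \<in> carrier_mat k m" and B: "B \<in> carrier_mat k k" and A: "A \<in> carrier_mat m m"
        and BA: "invertible_mat B \<and> upper_triangular B \<and> invertible_mat A \<and> upper_triangular A"
      let ?Q = "map_mat \<iota> B * P * map_mat \<iota> A + map_mat \<iota> C"
      have Q: "?Q \<in> carrier_mat k m" using C by simp
      show "full_superregular ?Q"
        unfolding full_superregular_iff_few_zeros[OF Q]
      proof (intro ballI impI, rule ccontr)
        fix x :: "'a vec"
        assume x: "x \<in> carrier_vec k" "x \<noteq> 0\<^sub>v k" and
          zeros: "\<not> card {i. i < k \<and> x $ i = 0} + card {j. j < m \<and> (?Q\<^sup>T *\<^sub>v x) $ j = 0} < k"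
        define u where "u = (map_mat \<iota> B)\<^sup>T *\<^sub>v x"
        have u: "u \<in> carrier_vec k"
          using B by (auto simp: u_def intro!: transpose_mult_vec_carrier)
        have "u \<noteq> 0\<^sub>v k"
        proof
          assume u0: "u = 0\<^sub>v k"
          \<comment> \<open>Since \<open>B\<close> can be undone, a nonzero \<open>x\<close> yields
            a nonzero message \<open>u\<close>, to which the rank bound applies.\<close>
          obtain B' where B': "B' \<in> carrier_mat k k" "(map_mat \<iota> B')\<^sup>T *\<^sub>v u = x"
            using map_mult_left_inverse[OF hom _ B] BA x(1) unfolding u_def by metis
          have "(map_mat \<iota> B')\<^sup>T *\<^sub>v u = 0\<^sub>v k"
            using B'(1) by (intro eq_vecI) (auto simp: u0)
          then show False using B'(2) x(2) by simp
        qed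
        moreover have "?dim u \<le> m"
          using zeros BA
          by (intro dim_le_of_many_zeros[OF hom P B A _ C x(1) refl _ u_def]) auto
        ultimately show False using large u by (meson leD)
      qed
    qed
  next
    assume regular: ?regular
    show ?large
    proof (intro ballI impI, rule ccontr)
      fix u assume u: "u \<in> carrier_vec k" "u \<noteq> 0\<^sub>v k" and "\<not> m < ?dim u"
      then have dim: "?dim u \<le> m" by simp
      obtain A B C x Q where B: "B \<in> carrier_mat k k" "invertible_mat B" "upper_triangular B"
        and A: "A \<in> carrier_mat m m" "invertible_mat A" "upper_triangular A"
        and C: "C \<in> carrier_mat k m" and x: "x \<in> carrier_vec k"
        and Q: "Q = map_mat \<iota> B * P * map_mat \<iota> A + map_mat \<iota> C"
        and zeros: "k \<le> card {i. i < k \<and> x $ i = 0} + card {j. j < m \<and> (Q\<^sup>T *\<^sub>v x) $ j = 0}"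
        and ux: "u = (map_mat \<iota> B)\<^sup>T *\<^sub>v x"
        by (rule many_zeros_of_dim_le[OF hom P u(1) dim])
      have "x \<noteq> 0\<^sub>v k"
      proof
        assume "x = 0\<^sub>v k"
        then have "u = 0\<^sub>v k" using B(1) by (intro eq_vecI) (auto simp: ux)
        then show False using u(2) by simp
      qed
      moreover have "Q \<in> carrier_mat k m" using C by (simp add: Q)
      moreover have "full_superregular Q" using regular A B C by (auto simp: Q)
      ultimately show False
        using zeros x full_superregular_iff_few_zeros[of Q k m] by fastforce
    qed
  qed
  then show ?thesis
    unfolding is_MRD_systematic_encoder_iff[OF hom assms(6) P assms(8), folded n] m_def .
qed

end
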